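(* Let $G$ be a periodic Abelian group (written additively) and let $X\subseteq G$ be a subset. Then $X$ is semiaffine if and only if at least one of the following conditions holds: (1) $X=(H+a)\cup(H+b)$ for some subgroup $H$ of $G$ and some elements $a,b\in X$; (2) $X=(H\setminus P)+g$ for some $g\in G$ and some subgroups $P\subseteq H$ of $G$ such that the quotient group $H/P$ contains no elements of even order.
   Context: A subset $X$ of an Abelian group $G$ is called semiaffine if for all $x,y,z\in X$ we have $x+(y-z)\in X$ or $x-(y-z)\in X$. (The empty set is semiaffine.) The order of an element $g$ of a group is the smallest positive integer $n$ with $ng=0$; if $ng\neq 0$ for all positive integers $n$, then $g$ has infinite order. A group is periodic if every element has finite order. An element has even order if its order is finite and even. For a subset $A\subseteq G$ and $g\in G$, $A+g:=\{u+g:u\in A\}$. *)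

theory Defs
  imports "HOL-Algebra.Multiplicative_Group"
begin

text \<open>
  The Abelian group is a \<^locale>\<open>comm_group\<close>, so its operation is written multiplicatively:
  \<open>x + y\<close>, \<open>x - y\<close> and \<open>A + g\<close> become \<open>x \<otimes> y\<close>, \<open>x \<otimes> inv y\<close> and \<open>A #> g\<close>.
\<close>

definition semiaffine :: "('a, 'b) monoid_scheme \<Rightarrow> 'a set \<Rightarrow> bool" where
  "semiaffine G X \<longleftrightarrow> X \<subseteq> carrier G \<and>
     (\<forall>x\<in>X. \<forall>y\<in>X. \<forall>z\<in>X.
        x \<otimes>\<^bsub>G\<^esub> (y \<otimes>\<^bsub>G\<^esub> inv\<^bsub>G\<^esub> z) \<in> X \<or>
        x \<otimes>\<^bsub>G\<^esub> inv\<^bsub>G\<^esub> (y \<otimes>\<^bsub>G\<^esub> inv\<^bsub>G\<^esub> z) \<in> X)"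

text \<open>
  \<open>group.ord G g\<close> is \<open>0\<close> exactly when \<open>g\<close> has infinite order; otherwise it is the least
  positive \<open>n\<close> with \<open>g [^] n = \<one>\<close>.  As \<open>0\<close> is even, finiteness of the order has to be
  required separately in the definition of even order.
\<close>

definition has_finite_order :: "('a, 'b) monoid_scheme \<Rightarrow> 'a \<Rightarrow> bool" where
  "has_finite_order G g \<longleftrightarrow> group.ord G g > 0"

definition has_even_order :: "('a, 'b) monoid_scheme \<Rightarrow> 'a \<Rightarrow> bool" where
  "has_even_order G g \<longleftrightarrow> has_finite_order G g \<and> even (group.ord G g)"

definition periodic :: "('a, 'b) monoid_scheme \<Rightarrow> bool" where
  "periodic G \<longleftrightarrow> (\<forall>g\<in>carrier G. has_finite_order G g)"

end

theory Submission
  imports Defs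
begin

text \<open>
  Write \<open>D = X - X\<close> additively, and let \<open>S\<close> be the stabilizer of \<open>D\<close>.  If \<open>x + u\<close> and \<open>x - u\<close> both
  lie in \<open>X\<close> for some \<open>x \<in> X\<close>, then \<open>u + D \<subseteq> D\<close>: for \<open>d \<in> D\<close>, either \<open>x + d \<in> X\<close> and
  \<open>u + d = (x + d) - (x - u)\<close>, or \<open>x - d \<in> X\<close> and \<open>u + d = (x + u) - (x - d)\<close>.  Consequently among
  any three points of \<open>X\<close> two are congruent modulo \<open>S\<close>, so \<open>X\<close> meets at most two cosets of \<open>S\<close>.

  If it meets two, \<open>S + p\<close> and \<open>S + p + c\<close> say, then \<open>2c \<notin> S\<close>, so for \<open>s \<in> S\<close> the point
  \<open>p - (s + c)\<close> lies in neither coset; hence \<open>p + (s + c) \<in> X\<close>, and \<open>X\<close> is the union of the two cosets.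
  If it meets only one, then \<open>D = S\<close>, and semiaffinity says precisely that the
  complement of \<open>X\<close> in its coset, translated to contain \<open>0\<close>, is closed under all midpoints in \<open>S\<close>.
  In a periodic group a midpoint-closed set containing \<open>0\<close> is a subgroup, and closure under halving
  means that the quotient has no element of order \<open>2\<close>.
\<close>

section \<open>Difference sets and their stabilizers\<close>

definition diffs :: "('a, 'b) monoid_scheme \<Rightarrow> 'a set \<Rightarrow> 'a set" where
  "diffs G X = {d \<in> carrier G. \<exists>z\<in>X. z \<otimes>\<^bsub>G\<^esub> d \<in> X}"

text \<open>Including \<open>inv s\<close> makes translation by \<open>s\<close> a bijection of
  \<open>A\<close>; in a general group the translations of \<open>A\<close> into itself form only a
  monoid.\<close>

definition stabilizer :: "('a, 'b) monoid_scheme \<Rightarrow> 'a set \<Rightarrow> 'a set" where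
  "stabilizer G A = {s \<in> carrier G. \<forall>d\<in>A. s \<otimes>\<^bsub>G\<^esub> d \<in> A \<and> inv\<^bsub>G\<^esub> s \<otimes>\<^bsub>G\<^esub> d \<in> A}"

context group
begin

lemma mult_inv_cancel_middle [simp]:
  assumes "x \<in> carrier G" "u \<in> carrier G" "d \<in> carrier G"
  shows "x \<otimes> u \<otimes> (inv u \<otimes> d) = x \<otimes> d" "x \<otimes> inv u \<otimes> (u \<otimes> d) = x \<otimes> d"
  using assms by (metis inv_closed inv_inv inv_solve_left m_assoc m_closed)+

lemma mult_inv_cancel_right [simp]:
  assumes "x \<in> carrier G" "u \<in> carrier G"
  shows "x \<otimes> u \<otimes> inv u = x" "x \<otimes> inv u \<otimes> u = x"
  using assms by (simp_all add: m_assoc)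

lemma stabilizer_subgroup:
  assumes A: "A \<subseteq> carrier G"
  shows "subgroup (stabilizer G A) G"
proof
  show "stabilizer G A \<subseteq> carrier G" by (auto simp: stabilizer_def)
  show "\<one> \<in> stabilizer G A" using A by (auto simp: stabilizer_def subsetD)
next
  fix x assume "x \<in> stabilizer G A"
  then show "inv x \<in> stabilizer G A" by (auto simp: stabilizer_def)
next
  fix x y assume "x \<in> stabilizer G A" "y \<in> stabilizer G A"
  then show "x \<otimes> y \<in> stabilizer G A"
    using A by (auto simp: stabilizer_def inv_mult_group m_assoc subset_iff)
qed

lemma stabilizer_subset: "\<one> \<in> A \<Longrightarrow> stabilizer G A \<subseteq> A"
  by (force simp: stabilizer_def)

section \<open>Elements of even order, and quotients without them\<close>

lemma even_order_imp_involution: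
  assumes c: "c \<in> carrier G" and even: "has_even_order G c"
  obtains e where "e \<in> carrier G" "e \<noteq> \<one>" "e \<otimes> e = \<one>"
proof -
  obtain k where k: "ord c = k + k" "k > 0"
    using even by (auto simp: has_even_order_def has_finite_order_def mult_2 elim!: evenE)
  have "c [^] k \<otimes> c [^] k = \<one>"
    using c k(1) by (metis nat_pow_mult pow_ord_eq_1)
  moreover have "c [^] k \<noteq> \<one>"
    using c k by (auto simp: pow_eq_id dest: dvd_imp_le)
  ultimately show thesis using that c by blast
qed

lemma involution_has_even_order:
  assumes "e \<in> carrier G" "e \<noteq> \<one>" "e \<otimes> e = \<one>"
  shows "has_even_order G e"
proof -
  have "e [^] (2::nat) = \<one>" using assms by (simp add: numeral_2_eq_2)
  then have "ord e dvd 2" using assms by (simp add: pow_eq_id)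
  then have "ord e \<le> 2" "ord e \<noteq> 0" by (auto dest: dvd_imp_le intro: Nat.gr0I)
  moreover have "ord e \<noteq> 1" using assms ord_eq_1[of e] by simp
  ultimately have "ord e = 2" by linarith
  then show ?thesis by (simp add: has_even_order_def has_finite_order_def)
qed

end

context comm_group
begin

text \<open>By the two preceding lemmas, even order can be tested on involutions alone, and the
  coset of \<open>h\<close> is an involution of the quotient exactly when
  \<open>h \<otimes> h\<close> is in \<open>P\<close> but \<open>h\<close> is not.\<close>

lemma quotient_no_even_order_iff:
  assumes P: "subgroup P G" and H: "subgroup H G" and PH: "P \<subseteq> H"
  shows "(\<forall>c \<in> carrier ((G\<lparr>carrier := H\<rparr>) Mod P). \<not> has_even_order ((G\<lparr>carrier := H\<rparr>) Mod P) c)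
    \<longleftrightarrow> (\<forall>h\<in>H. h \<otimes> h \<in> P \<longrightarrow> h \<in> P)"
proof -
  let ?K = "G\<lparr>carrier := H\<rparr>"
  interpret K: comm_group ?K 
    using subgroup.subgroup_is_group[OF H is_group] subgroup.mem_carrier[OF H]
    by (intro group.group_comm_groupI) (auto simp: m_comm)
  have PK: "subgroup P ?K" using P H PH by (simp add: subgroup_incl)
  interpret N: normal P ?K using PK by (rule K.subgroup_imp_normal)
  interpret Q: group "?K Mod P" by (rule N.factorgroup_is_group)
  have car: "carrier (?K Mod P) = {P #> h | h. h \<in> H}"
    by (auto simp: FactGroup_def RCOSETS_def r_coset_def)
  have mem: "P #> h = P \<longleftrightarrow> h \<in> P" if "h \<in> H" for h
    using that P H by (metis coset_join1 coset_join2 subgroup.mem_carrier subgroup.rcos_const is_group)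
  have sq: "(P #> h) \<otimes>\<^bsub>?K Mod P\<^esub> (P #> h) = P #> (h \<otimes> h)" if "h \<in> H" for h
    using N.rcos_sum[of h h] that by (simp add: FactGroup_def r_coset_def set_mult_def)
  have one: "\<one>\<^bsub>?K Mod P\<^esub> = P" by simp
  show ?thesis
  proof (intro iffI ballI impI notI)
    fix h assume *: "\<forall>c \<in> carrier (?K Mod P). \<not> has_even_order (?K Mod P) c" "h \<in> H" "h \<otimes> h \<in> P"
    have "h \<otimes> h \<in> H" using * PH by blast
    then show "h \<in> P" using * Q.involution_has_even_order[of "P #> h"] sq[of h] mem[of h] mem[of "h \<otimes> h"] car one
      by auto
  next
    fix c assume *: "\<forall>h\<in>H. h \<otimes> h \<in> P \<longrightarrow> h \<in> P" "c \<in> carrier (?K Mod P)" "has_even_order (?K Mod P) c"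
    then obtain e where e: "e \<in> carrier (?K Mod P)" "e \<noteq> P" "e \<otimes>\<^bsub>?K Mod P\<^esub> e = P"
      using Q.even_order_imp_involution one by metis
    then obtain h where h: "h \<in> H" "e = P #> h" using car by auto
    have "h \<otimes> h \<in> H" using h H by (simp add: subgroup.m_closed)
    then show False using * e h sq[of h] mem[of h] mem[of "h \<otimes> h"] by auto
  qed
qed

section \<open>Midpoint-closed subsets of periodic groups\<close>

text \<open>The crux is closure under squaring: \<open>p \<otimes> q\<close> is a midpoint of
  \<open>p \<otimes> p\<close> and \<open>q \<otimes> q\<close>, so products follow, and inverses
  are powers by periodicity.\<close>

lemma midpoint_closed_imp_subgroup:
  assumes per: "periodic G" and H: "subgroup H G" and PH: "P \<subseteq> H" and one: "\<one> \<in> P"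
    and mid: "\<And>p q h. p \<in> P \<Longrightarrow> q \<in> P \<Longrightarrow> h \<in> H \<Longrightarrow> p \<otimes> q = h \<otimes> h \<Longrightarrow> h \<in> P"
  shows "subgroup P G"
proof -
  note Hc = subgroup.m_closed[OF H] subgroup.mem_carrier[OF H] subgroup.subset[OF H]
  have powH: "h [^] (n::nat) \<in> H" if "h \<in> H" for h n
    using that H by (induction n) (auto simp: subgroup.one_closed subgroup.m_closed)
  have halve: "h \<in> P" if "h \<in> H" "h [^] ((2::nat) ^ n) \<in> P" for h n
    using that
  proof (induction n)
    case (Suc n)
    have "h [^] ((2::nat) ^ n) \<otimes> h [^] ((2::nat) ^ n) = h [^] ((2::nat) ^ Suc n)"
      using Suc.prems Hc(2) by (simp add: nat_pow_mult mult_2)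
    then have "h [^] ((2::nat) ^ n) \<in> P"
      using mid[OF Suc.prems(2) one powH[OF Suc.prems(1)]] Suc.prems Hc(2) PH by auto
    then show ?case using Suc by blast
  qed (use Hc in auto)
  \<comment> \<open>\<open>c \<otimes> t\<close> is a midpoint of \<open>c\<close> and
    \<open>c \<otimes> (t \<otimes> t)\<close>, and \<open>t \<otimes> t\<close> needs one squaring
    fewer to reach \<open>\<one>\<close>.\<close>
  have torsion: "c \<otimes> t \<in> P" if "c \<in> P" "t \<in> H" "t [^] ((2::nat) ^ n) = \<one>" for c t n
    using that
  proof (induction n arbitrary: t)
    case 0
    then show ?case using Hc PH by auto
  next
    case (Suc n)
    have c: "c \<in> H" "c \<in> carrier G" "t \<in> carrier G" using Suc.prems Hc(2) PH by auto
    have "(t \<otimes> t) [^] ((2::nat) ^ n) = \<one>"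
      using Suc.prems(3) c by (simp add: nat_pow_distrib nat_pow_mult mult_2)
    then have "c \<otimes> (t \<otimes> t) \<in> P" using Suc Hc(1) by blast
    moreover have "c \<otimes> (c \<otimes> (t \<otimes> t)) = (c \<otimes> t) \<otimes> (c \<otimes> t)" using c by (simp add: m_ac)
    ultimately show ?case using mid Suc.prems(1,2) c Hc(1) by blast
  qed
  text \<open>By pigeonhole \<open>c [^] (2 ^ (n + 1))\<close> and \<open>c\<close> differ by a 2-power torsion element for some \<open>n\<close>,
    so \<open>c \<otimes> c\<close> is reached from an element of \<open>P\<close> by \<open>n\<close> halvings.\<close>
  have double: "c \<otimes> c \<in> P" if "c \<in> P" for c
  proof -
    have cH: "c \<in> H" and c: "c \<in> carrier G" using that PH Hc(2) by auto
    have "ord c > 0" using per c by (auto simp: periodic_def has_finite_order_def)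
    then have "range (\<lambda>i. (2::nat) ^ i mod ord c) \<subseteq> {..<ord c}" by auto
    then have "\<not> inj (\<lambda>i. (2::nat) ^ i mod ord c)"
      using finite_subset range_inj_infinite by blast
    then obtain i j :: nat where "i < j" and ij: "(2::nat) ^ i mod ord c = 2 ^ j mod ord c"
      by (auto simp: inj_def) (metis nat_neq_iff)
    \<comment> \<open>The successor matters: \<open>c [^] (2 ^ Suc n)\<close> is a
      \<open>2 ^ n\<close>-th power of \<open>c \<otimes> c\<close>, so the halvings stop at
      \<open>c \<otimes> c\<close> and not at \<open>c\<close>.\<close>
    then obtain n where j: "j = Suc n + i" by (metis add.commute add_Suc_right less_iff_Suc_add)
    have red: "c [^] n = c [^] (n mod ord c)" for n :: nat
    proof -
      have "c [^] n = c [^] (ord c * (n div ord c) + n mod ord c)" by simp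
      also have "\<dots> = c [^] (ord c * (n div ord c)) \<otimes> c [^] (n mod ord c)"
        using c by (simp only: nat_pow_mult)
      also have "\<dots> = c [^] (n mod ord c)"
        using c by (simp add: nat_pow_pow[symmetric])
      finally show ?thesis .
    qed
    have "c [^] ((2::nat) ^ i) = c [^] ((2::nat) ^ j)"
      using c ij red by metis
    \<comment> \<open>\<open>t\<close> is the factor that carries \<open>c\<close> to
      \<open>c [^] (2 ^ Suc n)\<close>; its \<open>2 ^ i\<close>-th power is the quotient of the two
      equal powers just found.\<close>
    moreover define t where "t = c [^] ((2::nat) ^ Suc n) \<otimes> inv c"
    ultimately have "t [^] ((2::nat) ^ i) = \<one>"
      using c by (simp add: nat_pow_distrib nat_pow_pow nat_pow_inv j power_add mult_ac)
    moreover have "t \<in> H"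
      using cH powH Hc(1) H unfolding t_def by (simp add: subgroup.m_inv_closed)
    ultimately have "c \<otimes> t \<in> P" using torsion that by blast
    moreover have "c \<otimes> t = c [^] ((2::nat) ^ Suc n)"
      using c unfolding t_def by (simp add: m_comm[of c])
    moreover have "c [^] ((2::nat) ^ Suc n) = (c \<otimes> c) [^] ((2::nat) ^ n)"
      using c by (simp add: nat_pow_distrib nat_pow_mult mult_2)
    ultimately show ?thesis using halve cH Hc(1) by simp
  qed
  have mult: "p \<otimes> q \<in> P" if "p \<in> P" "q \<in> P" for p q
  proof -
    have c: "p \<in> H" "q \<in> H" "p \<in> carrier G" "q \<in> carrier G" using that PH Hc(2) by auto
    then have "(p \<otimes> p) \<otimes> (q \<otimes> q) = (p \<otimes> q) \<otimes> (p \<otimes> q)" by (simp add: m_ac)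
    then show ?thesis using mid[OF double double] that c Hc(1) by blast
  qed
  have pow: "p [^] (n::nat) \<in> P" if "p \<in> P" for p n
    using that by (induction n) (auto simp: one mult)
  show ?thesis
  proof
    show "P \<subseteq> carrier G" using PH Hc by auto
    show "inv p \<in> P" if "p \<in> P" for p
    proof -
      have c: "p \<in> carrier G" using that PH Hc by auto
      then have "ord p > 0" using per by (auto simp: periodic_def has_finite_order_def)
      then obtain n where "ord p = Suc n" using gr0_implies_Suc by blast
      then have "p [^] n \<otimes> p = \<one>" using pow_ord_eq_1[OF c] by simp
      then have "inv p = p [^] n" using c by (simp add: inv_equality)
      then show ?thesis using pow that by simp
    qed
  qed (use one mult in auto)
qed

section \<open>Displacements between points of a semiaffine set\<close>

lemma diffsI: "y \<in> X \<Longrightarrow> z \<in> X \<Longrightarrow> X \<subseteq> carrier G \<Longrightarrow> y \<otimes> inv z \<in> diffs G X"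
  by (auto simp: diffs_def m_ac subset_iff intro!: bexI[of _ z])

lemma diffsE:
  assumes "d \<in> diffs G X" "X \<subseteq> carrier G"
  obtains y z where "y \<in> X" "z \<in> X" "d = y \<otimes> inv z"
proof -
  obtain z where z: "z \<in> X" "z \<otimes> d \<in> X" "d \<in> carrier G"
    using assms(1) by (auto simp: diffs_def)
  then have "d = z \<otimes> d \<otimes> inv z" using assms(2) by (simp add: m_comm[of z d] subset_iff)
  then show thesis using that z by blast
qed

lemma semiaffine_diffs:
  "semiaffine G X \<longleftrightarrow> X \<subseteq> carrier G \<and> (\<forall>x\<in>X. \<forall>d\<in>diffs G X. x \<otimes> d \<in> X \<or> x \<otimes> inv d \<in> X)"
proof (intro iffI conjI ballI)
  assume sa: "semiaffine G X"
  then show "X \<subseteq> carrier G" by (simp add: semiaffine_def)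
  fix x d assume x: "x \<in> X" and "d \<in> diffs G X"
  then obtain z where z: "z \<in> X" "z \<otimes> d \<in> X" "d \<in> carrier G" by (auto simp: diffs_def)
  then have "z \<in> carrier G" using sa by (auto simp: semiaffine_def)
  then have "z \<otimes> d \<otimes> inv z = d" using z by (simp add: m_comm[of z d])
  then show "x \<otimes> d \<in> X \<or> x \<otimes> inv d \<in> X"
    using sa x z unfolding semiaffine_def by metis
next
  assume "X \<subseteq> carrier G \<and> (\<forall>x\<in>X. \<forall>d\<in>diffs G X. x \<otimes> d \<in> X \<or> x \<otimes> inv d \<in> X)"
  then show "semiaffine G X" using diffsI by (auto simp: semiaffine_def)
qed

lemma symmetric_step_mem_stabilizer:
  assumes sa: "semiaffine G X" and u: "u \<in> carrier G"
    and x: "x \<in> X" "x \<otimes> u \<in> X" "x \<otimes> inv u \<in> X"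
  shows "u \<in> stabilizer G (diffs G X)"
proof -
  have X: "X \<subseteq> carrier G" and
    step: "\<And>x d. x \<in> X \<Longrightarrow> d \<in> diffs G X \<Longrightarrow> x \<otimes> d \<in> X \<or> x \<otimes> inv d \<in> X"
    using sa by (auto simp: semiaffine_diffs)
  \<comment> \<open>The hypotheses on \<open>v\<close> are invariant under inversion, so this serves
    for both \<open>u\<close> and \<open>inv u\<close>.\<close>
  have *: "v \<otimes> d \<in> diffs G X"
    if v: "v \<in> carrier G" "x \<otimes> v \<in> X" "x \<otimes> inv v \<in> X" and d: "d \<in> diffs G X" for v d
  proof -
    have c: "x \<in> carrier G" "d \<in> carrier G" using x X d by (auto simp: diffs_def)
    from step[OF x(1) d] show ?thesis
    proof
      assume "x \<otimes> d \<in> X"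
      moreover have "x \<otimes> inv v \<otimes> (v \<otimes> d) = x \<otimes> d" using c v by simp
      ultimately show ?thesis using c v unfolding diffs_def by force
    next
      assume "x \<otimes> inv d \<in> X"
      moreover have "x \<otimes> inv d \<otimes> (v \<otimes> d) = x \<otimes> v" using c v by (simp add: m_comm[of v d])
      ultimately show ?thesis using c v unfolding diffs_def by force
    qed
  qed
  show ?thesis using *[of u] *[of "inv u"] u x by (auto simp: stabilizer_def)
qed

text \<open>Among the three points completing \<open>x, y, z\<close> to a parallelogram at least two lie in \<open>X\<close>,
  and they are symmetric about one of \<open>x, y, z\<close>.\<close>

lemma three_points_mod_stabilizer:
  assumes sa: "semiaffine G X" and x: "x \<in> X" and y: "y \<in> X" and z: "z \<in> X"
  defines "S \<equiv> stabilizer G (diffs G X)"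
  shows "x \<otimes> inv y \<in> S \<or> x \<otimes> inv z \<in> S \<or> y \<otimes> inv z \<in> S"
proof -
  have c: "x \<in> carrier G" "y \<in> carrier G" "z \<in> carrier G"
    using sa x y z by (auto simp: semiaffine_def)
  have step: "a \<otimes> (b \<otimes> inv e) \<in> X \<or> a \<otimes> inv (b \<otimes> inv e) \<in> X" if "a \<in> X" "b \<in> X" "e \<in> X" for a b e
    using sa that by (auto simp: semiaffine_def)
  \<comment> \<open>Additively the completions are x+y-z, x+z-y and y+z-x. Semiaffinity at each of
    the three points puts one of a different pair of them into \<open>X\<close>, so at most one is
    missing.\<close>
  have eqs: "x \<otimes> inv (y \<otimes> inv z) = z \<otimes> (x \<otimes> inv y)"
    "y \<otimes> (x \<otimes> inv z) = x \<otimes> (y \<otimes> inv z)"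
    "y \<otimes> inv (x \<otimes> inv z) = z \<otimes> inv (x \<otimes> inv y)"
    using c by (simp_all add: inv_mult m_ac)
  have S: "a \<otimes> inv b \<in> S" if "e \<in> X" "e \<otimes> (a \<otimes> inv b) \<in> X" "e \<otimes> inv (a \<otimes> inv b) \<in> X"
    "a \<in> carrier G" "b \<in> carrier G" for a b e
    using symmetric_step_mem_stabilizer[OF sa, of "a \<otimes> inv b" e] that unfolding S_def by simp
  show ?thesis
    using step[OF x y z] step[OF y x z] step[OF z x y] S[OF x _ _ c(2,3)] S[OF y _ _ c(1,3)]
      S[OF z _ _ c(1,2)] eqs by metis
qed

lemma div_div_swap:
  assumes "a \<in> carrier G" "b \<in> carrier G" "c \<in> carrier G" "d \<in> carrier G"
  shows "(a \<otimes> inv b) \<otimes> inv (c \<otimes> inv d) = (a \<otimes> inv c) \<otimes> inv (b \<otimes> inv d)"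
  using assms by (simp add: inv_mult m_ac)

lemma one_mem_diffs: "x \<in> X \<Longrightarrow> X \<subseteq> carrier G \<Longrightarrow> \<one> \<in> diffs G X"
  by (auto simp: diffs_def subset_iff)

section \<open>The shape of a semiaffine set, by the number of cosets it meets\<close>

lemma semiaffine_single_coset:
  assumes sa: "semiaffine G X" and x: "x \<in> X"
    and single: "\<not> (\<exists>a\<in>X. \<exists>b\<in>X. b \<otimes> inv a \<notin> stabilizer G (diffs G X))"
  shows "diffs G X = stabilizer G (diffs G X)"
proof
  have X: "X \<subseteq> carrier G" using sa by (simp add: semiaffine_def)
  show "stabilizer G (diffs G X) \<subseteq> diffs G X"
    using one_mem_diffs[OF x X] by (rule stabilizer_subset)
  show "diffs G X \<subseteq> stabilizer G (diffs G X)"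
  proof
    fix d assume "d \<in> diffs G X"
    then obtain y z where "y \<in> X" "z \<in> X" "d = y \<otimes> inv z" using X by (rule diffsE)
    then show "d \<in> stabilizer G (diffs G X)" using single by blast
  qed
qed

lemma semiaffine_two_cosets:
  assumes sa: "semiaffine G X" and a: "a \<in> X" and b: "b \<in> X"
    and ab: "b \<otimes> inv a \<notin> stabilizer G (diffs G X)"
  shows "X = (stabilizer G (diffs G X) #> a) \<union> (stabilizer G (diffs G X) #> b)"
proof -
  define D where "D = diffs G X"
  define S where "S = stabilizer G D"
  have X: "X \<subseteq> carrier G" and
    step: "\<And>x d. x \<in> X \<Longrightarrow> d \<in> D \<Longrightarrow> x \<otimes> d \<in> X \<or> x \<otimes> inv d \<in> X"
    using sa unfolding semiaffine_diffs D_def by blast+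
  have Dc: "D \<subseteq> carrier G" by (auto simp: D_def diffs_def)
  have S: "subgroup S G" unfolding S_def using Dc by (rule stabilizer_subgroup)
  interpret S: subgroup S G by (rule S)
  have SD: "S \<subseteq> D" unfolding S_def D_def using one_mem_diffs[OF a X] by (rule stabilizer_subset)
  have act: "s \<otimes> d \<in> D" if "s \<in> S" "d \<in> D" for s d using that unfolding S_def stabilizer_def by blast
  have Sdiff: "y \<otimes> inv x \<in> S" if "x \<otimes> inv y \<in> S" "x \<in> X" "y \<in> X" for x y
  proof -
    have "inv (x \<otimes> inv y) = y \<otimes> inv x" using that X by (simp add: subset_iff inv_mult_group)
    then show ?thesis using S.m_inv_closed[OF that(1)] by simp
  qed
  have cover: "x \<otimes> inv p \<in> S \<or> x \<otimes> inv q \<in> S" if "p \<in> X" "q \<in> X" "q \<otimes> inv p \<notin> S" "x \<in> X" for x p q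
    using three_points_mod_stabilizer[OF sa that(4) that(1,2), folded D_def, folded S_def]
      Sdiff[OF _ that(1,2)] that(3) by blast
  have coset: "x \<in> S #> y \<longleftrightarrow> x \<otimes> inv y \<in> S" if "x \<in> carrier G" "y \<in> carrier G" for x y
    using that S.rcos_module[OF is_group] by simp
  text \<open>If the cosets of \<open>p\<close> and \<open>q\<close> differed by an involution modulo \<open>S\<close>, then \<open>D\<close> would be a
    subgroup and \<open>S\<close> would be all of it.\<close>
  have no_inv: "(q \<otimes> inv p) \<otimes> (q \<otimes> inv p) \<notin> S" if pq: "p \<in> X" "q \<in> X" "q \<otimes> inv p \<notin> S" for p q
  proof
    define c where "c = q \<otimes> inv p"
    assume "(q \<otimes> inv p) \<otimes> (q \<otimes> inv p) \<in> S"
    then have cc: "c \<otimes> c \<in> S" by (simp add: c_def)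
    have pqc: "p \<in> carrier G" "q \<in> carrier G" using pq X by auto
    have cD: "c \<in> D" using diffsI[OF pq(2,1) X] by (simp add: D_def c_def)
    then have c: "c \<in> carrier G" using Dc by blast
    have ic: "inv c = p \<otimes> inv q" using pqc by (simp add: c_def inv_mult_group)
    \<comment> \<open>So \<open>D\<close> is made of the cosets of \<open>\<one>\<close> and
      \<open>c\<close> modulo \<open>S\<close>, which translation by \<open>c\<close> exchanges
      because \<open>c \<otimes> c\<close> is in \<open>S\<close>.\<close>
    have D: "d \<in> S \<or> d \<otimes> inv c \<in> S" if "d \<in> D" for d
    proof -
      obtain y z where d: "y \<in> X" "z \<in> X" "d = y \<otimes> inv z"
        using \<open>d \<in> D\<close> X unfolding D_def by (rule diffsE)
      have cs: "y \<in> carrier G" "z \<in> carrier G" using d X by auto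
      have same: "d \<in> S" if "y \<otimes> inv r \<in> S" "z \<otimes> inv r \<in> S" "r \<in> carrier G" for r
      proof -
        have "d = (y \<otimes> inv r) \<otimes> inv (z \<otimes> inv r)"
          using div_div_swap[of y r z r] that cs d(3) by simp
        then show ?thesis using that(1,2) by simp
      qed
      consider "y \<otimes> inv p \<in> S" "z \<otimes> inv p \<in> S" | "y \<otimes> inv q \<in> S" "z \<otimes> inv q \<in> S"
        | "y \<otimes> inv q \<in> S" "z \<otimes> inv p \<in> S" | "y \<otimes> inv p \<in> S" "z \<otimes> inv q \<in> S"
        using cover[OF pq d(1)] cover[OF pq d(2)] by blast
      then show ?thesis
      proof cases
        case 1
        then show ?thesis using same pqc by blast
      next
        case 2
        then show ?thesis using same pqc by blast
      next
        case 3
        have "d \<otimes> inv c = (y \<otimes> inv q) \<otimes> inv (z \<otimes> inv p)"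
          using div_div_swap[of y z q p] cs pqc d(3) c_def by simp
        then show ?thesis using 3 by simp
      next
        \<comment> \<open>Here \<open>d\<close> lies in the coset of \<open>inv c\<close>, which is
          the coset of \<open>c\<close> because \<open>c \<otimes> c\<close> is in
          \<open>S\<close>.\<close>
        case 4
        have "d \<otimes> c = d \<otimes> inv (inv c)" using c by simp
        also have "\<dots> = (y \<otimes> inv p) \<otimes> inv (z \<otimes> inv q)"
          using div_div_swap[of y z p q] cs pqc d(3) ic by simp
        finally have "d \<otimes> c \<in> S" using 4 by simp
        moreover have "d \<otimes> inv c = d \<otimes> c \<otimes> inv (c \<otimes> c)"
          using c cs d(3) by (simp add: inv_mult)
        ultimately show ?thesis using cc by simp
      qed
    qed
    have 1: "c \<otimes> d \<in> D" if d: "d \<in> D" for d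
      using D[OF d]
    proof
      assume "d \<in> S"
      then show ?thesis using act[OF _ cD, of d] c S.subset by (simp add: m_comm[of c d] subset_iff)
    next
      assume *: "d \<otimes> inv c \<in> S"
      have "d \<in> carrier G" using d Dc by auto
      then have "c \<otimes> d = (d \<otimes> inv c) \<otimes> (c \<otimes> c)" using c by (simp add: m_comm[of c d])
      then show ?thesis using S.m_closed[OF * cc] SD by auto
    qed
    \<comment> \<open>Translation by \<open>inv c\<close> is translation by \<open>c\<close>
      followed by one by \<open>inv (c \<otimes> c)\<close>, an element of \<open>S\<close>.\<close>
    have 2: "inv c \<otimes> d \<in> D" if d: "d \<in> D" for d
    proof -
      have "d \<in> carrier G" using d Dc by auto
      then have "inv c \<otimes> d = inv (c \<otimes> c) \<otimes> (c \<otimes> d)" using c by (simp add: inv_mult)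
      then show ?thesis using act[OF S.m_inv_closed[OF cc] 1[OF d]] by simp
    qed
    have "c \<in> S" using c 1 2 unfolding S_def stabilizer_def by blast
    then show False using pq(3) by (simp add: c_def)
  qed
  \<comment> \<open>Kept general in \<open>p\<close> and \<open>q\<close> so that swapping
    \<open>a\<close> and \<open>b\<close> fills the other coset too.\<close>
  have full: "s \<otimes> q \<in> X" if s: "s \<in> S" and pq: "p \<in> X" "q \<in> X" "q \<otimes> inv p \<notin> S" for s p q
  proof -
    define c where "c = q \<otimes> inv p"
    have cs: "s \<in> carrier G" "p \<in> carrier G" "q \<in> carrier G" "c \<in> carrier G"
      using s pq X by (auto simp: c_def)
    have cS: "c \<notin> S" using pq(3) by (simp add: c_def)
    have ccS: "c \<otimes> c \<notin> S" using no_inv[OF pq] by (simp add: c_def)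
    have cD: "c \<in> D" using diffsI[OF pq(2,1) X] by (simp add: D_def c_def)
    have d: "s \<otimes> c \<in> D" using act[OF s cD] .
    have ic: "p \<otimes> inv q = inv c" using cs(2,3) by (simp add: c_def inv_mult_group)
    have "q = c \<otimes> p" using cs(2,3) by (simp add: c_def)
    then have "p \<otimes> (s \<otimes> c) = s \<otimes> q" using cs by (simp add: m_ac)
    moreover have "p \<otimes> inv (s \<otimes> c) \<notin> X"
    proof
      define w where "w = inv (s \<otimes> c)"
      assume "p \<otimes> inv (s \<otimes> c) \<in> X"
      then have w: "p \<otimes> w \<in> X" by (simp add: w_def)
      have wc: "w \<in> carrier G" using cs by (simp add: w_def)
      from cover[OF pq w] show False
      proof
        assume "p \<otimes> w \<otimes> inv p \<in> S"
        then have "w \<in> S" using cs wc by (simp add: m_comm[of p w])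
        then have "s \<otimes> c \<in> S" using S.m_inv_closed[of w] cs by (simp add: w_def)
        then have "inv s \<otimes> (s \<otimes> c) \<in> S" using s by simp
        then show False using cS cs by (simp flip: m_assoc)
      next
        assume "p \<otimes> w \<otimes> inv q \<in> S"
        then have "w \<otimes> inv c \<in> S" using cs wc ic by (simp add: m_comm[of p w] m_assoc)
        then have "inv (w \<otimes> inv c) \<in> S" by simp
        then have "s \<otimes> c \<otimes> c \<in> S" using cs by (simp add: w_def inv_mult_group m_comm)
        then have "inv s \<otimes> (s \<otimes> c \<otimes> c) \<in> S" using s by simp
        then show False using ccS cs by (simp flip: m_assoc)
      qed
    qed
    ultimately show ?thesis using step[OF pq(1) d] by simp
  qed
  have ab': "b \<otimes> inv a \<notin> S" using ab by (simp add: S_def D_def)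
  then have ba: "a \<otimes> inv b \<notin> S" using Sdiff[OF _ a b] by blast
  have "X = (S #> a) \<union> (S #> b)"
  proof
    show "X \<subseteq> (S #> a) \<union> (S #> b)"
    proof
      fix x assume x: "x \<in> X"
      have "x \<in> carrier G" "a \<in> carrier G" "b \<in> carrier G" using x a b X by auto
      then show "x \<in> (S #> a) \<union> (S #> b)" using cover[OF a b ab' x] coset by simp
    qed
    show "(S #> a) \<union> (S #> b) \<subseteq> X" 
      using full[OF _ a b ab'] full[OF _ b a ba] unfolding r_coset_def by blast
  qed
  then show ?thesis by (simp add: S_def D_def)
qed

lemma semiaffine_coset_diff:
  assumes per: "periodic G" and sa: "semiaffine G X" and x: "x \<in> X"
    and S: "subgroup S G" and D: "diffs G X = S" and neq: "X \<noteq> S #> x"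
  shows "\<exists>P g. g \<in> carrier G \<and> subgroup P G \<and> P \<subseteq> S \<and> (\<forall>h\<in>S. h \<otimes> h \<in> P \<longrightarrow> h \<in> P)
    \<and> X = (S - P) #> g"
proof -
  have X: "X \<subseteq> carrier G" and
    step: "\<And>x d. x \<in> X \<Longrightarrow> d \<in> S \<Longrightarrow> x \<otimes> d \<in> X \<or> x \<otimes> inv d \<in> X"
    using sa D by (auto simp: semiaffine_diffs)
  interpret S: subgroup S G by (rule S)
  have coset: "u \<in> S #> y \<longleftrightarrow> u \<otimes> inv y \<in> S" if "u \<in> carrier G" "y \<in> carrier G" for u y
    using that S.rcos_module[OF is_group] by simp
  have "X \<subseteq> S #> x" using diffsI[OF _ x X] x X coset unfolding D by blast
  \<comment> \<open>A base point in the coset but outside \<open>X\<close> is what puts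
    \<open>\<one>\<close> into the set \<open>P\<close> below.\<close>
  then obtain g where g: "g \<in> S #> x" "g \<notin> X" using neq by blast
  have xc: "x \<in> carrier G" using x X by auto
  have gc: "g \<in> carrier G" using g xc S.subset r_coset_subset_G by blast
  have Xg: "X \<subseteq> S #> g" using \<open>X \<subseteq> S #> x\<close> repr_independence[OF g(1) xc S] by simp
  define P where "P = {p \<in> S. p \<otimes> g \<notin> X}"
  \<comment> \<open>If \<open>h \<otimes> g\<close> were in \<open>X\<close>, the displacement
    \<open>p \<otimes> inv h\<close> would take it forwards to \<open>p \<otimes> g\<close> and
    backwards to \<open>q \<otimes> g\<close>, both outside \<open>X\<close>.\<close>
  have mid: "h \<in> P" if "p \<in> P" "q \<in> P" "h \<in> S" "p \<otimes> q = h \<otimes> h" for p q h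
  proof (rule ccontr)
    assume "h \<notin> P"
    then have hX: "h \<otimes> g \<in> X" using that by (simp add: P_def)
    have c: "p \<in> carrier G" "q \<in> carrier G" "h \<in> carrier G" "p \<in> S" "q \<in> S" using that by (auto simp: P_def)
    have "h \<otimes> g \<otimes> (p \<otimes> inv h) = p \<otimes> g" using c gc by (simp add: m_ac)
    moreover have "q = inv p \<otimes> (h \<otimes> h)" using c that by (simp add: inv_solve_left)
    then have "h \<otimes> g \<otimes> inv (p \<otimes> inv h) = q \<otimes> g" using c gc by (simp add: inv_mult m_ac)
    ultimately show False using step[OF hX, of "p \<otimes> inv h"] that c by (auto simp: P_def)
  qed
  have PS: "P \<subseteq> S" by (auto simp: P_def)
  have one: "\<one> \<in> P" using g gc by (simp add: P_def)
  have "subgroup P G" using per S PS one mid by (rule midpoint_closed_imp_subgroup)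
  moreover have "h \<in> P" if "h \<in> S" "h \<otimes> h \<in> P" for h
    using mid[OF that(2) one that(1)] that by simp
  moreover have "X = (S - P) #> g" using Xg by (auto simp: P_def r_coset_def)
  ultimately show ?thesis using gc PS by blast
qed

section \<open>Both families of sets are semiaffine\<close>

lemma two_cosets_semiaffine:
  assumes H: "subgroup H G" and ab: "a \<in> carrier G" "b \<in> carrier G"
  shows "semiaffine G ((H #> a) \<union> (H #> b))" (is "semiaffine G ?X")
proof -
  interpret H: subgroup H G by (rule H)
  have X: "?X \<subseteq> carrier G" using ab H.subset r_coset_subset_G by blast
  have clo: "h \<otimes> u \<in> ?X" if "h \<in> H" "u \<in> ?X" for h u
  proof -
    obtain k v where k: "k \<in> H" "v \<in> {a, b}" "u = k \<otimes> v"
      using \<open>u \<in> ?X\<close> by (auto simp: r_coset_def)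
    then have "h \<otimes> u = (h \<otimes> k) \<otimes> v" using that ab by (auto simp: m_assoc)
    moreover have "h \<otimes> k \<in> H" using that k by simp
    ultimately show ?thesis using k(2) by (auto simp: r_coset_def)
  qed
  have same: "u \<otimes> inv v \<in> H" if uv: "u \<in> H #> r" "v \<in> H #> r" and r: "r \<in> carrier G" for u v r
  proof -
    obtain h k where "h \<in> H" "k \<in> H" "u = h \<otimes> r" "v = k \<otimes> r" using uv by (auto simp: r_coset_def)
    moreover from this have "u \<otimes> inv v = h \<otimes> inv k"
      using r div_div_swap[of h "inv r" k "inv r"] by simp
    ultimately show ?thesis by simp
  qed
  have "x \<otimes> (y \<otimes> inv z) \<in> ?X \<or> x \<otimes> inv (y \<otimes> inv z) \<in> ?X"
    if xyz: "x \<in> ?X" "y \<in> ?X" "z \<in> ?X" for x y z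
  proof -
    have c: "x \<in> carrier G" "y \<in> carrier G" "z \<in> carrier G" using xyz X by auto
    \<comment> \<open>By pigeonhole two of the three points share a coset; their quotient then acts
      on the third point without leaving the union.\<close>
    have "y \<otimes> inv z \<in> H \<or> x \<otimes> inv z \<in> H \<or> x \<otimes> inv y \<in> H"
      using xyz same ab by blast
    then have "(y \<otimes> inv z) \<otimes> x \<in> ?X \<or> (x \<otimes> inv z) \<otimes> y \<in> ?X \<or> (x \<otimes> inv y) \<otimes> z \<in> ?X"
      using clo xyz by blast
    moreover have "x \<otimes> (y \<otimes> inv z) = (y \<otimes> inv z) \<otimes> x" "x \<otimes> (y \<otimes> inv z) = (x \<otimes> inv z) \<otimes> y"
      "x \<otimes> inv (y \<otimes> inv z) = (x \<otimes> inv y) \<otimes> z"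
      using c by (simp_all add: inv_mult m_ac)
    ultimately show ?thesis by metis
  qed
  then show ?thesis using X by (simp add: semiaffine_def)
qed

text \<open>With \<open>x = u \<otimes> g\<close>, the two candidates \<open>u \<otimes> e\<close>
  and \<open>u \<otimes> inv e\<close> have product \<open>u \<otimes> u\<close>. If both were in
  \<open>P\<close>, halving would put \<open>u\<close> into \<open>P\<close>.\<close>

lemma coset_diff_semiaffine:
  assumes P: "subgroup P G" and H: "subgroup H G" and g: "g \<in> carrier G"
    and halve: "\<And>h. h \<in> H \<Longrightarrow> h \<otimes> h \<in> P \<Longrightarrow> h \<in> P"
  shows "semiaffine G ((H - P) #> g)"
  unfolding semiaffine_def
proof (intro conjI ballI)
  interpret H: subgroup H G by (rule H)
  show "(H - P) #> g \<subseteq> carrier G" using H.subset g by (intro r_coset_subset_G) auto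
  fix x y z assume "x \<in> (H - P) #> g" "y \<in> (H - P) #> g" "z \<in> (H - P) #> g"
  then obtain u v w where uvw: "u \<in> H" "u \<notin> P" "v \<in> H" "w \<in> H"
    and eq: "x = u \<otimes> g" "y = v \<otimes> g" "z = w \<otimes> g"
    by (auto simp: r_coset_def)
  define e where "e = v \<otimes> inv w"
  have e: "e \<in> H" using uvw by (simp add: e_def)
  have yz: "y \<otimes> inv z = e"
    using uvw g div_div_swap[of v "inv g" w "inv g"] by (simp add: eq e_def)
  have mem: "h \<otimes> g \<in> (H - P) #> g" if "h \<in> H" "h \<notin> P" for h
    using that by (auto simp: r_coset_def)
  have "(u \<otimes> e) \<otimes> (u \<otimes> inv e) = u \<otimes> u"
    using uvw e by (simp add: m_comm[of u "inv e"])
  then have "u \<otimes> e \<notin> P \<or> u \<otimes> inv e \<notin> P"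
    using halve[OF uvw(1)] uvw(2) subgroup.m_closed[OF P] by metis
  moreover have "x \<otimes> e = (u \<otimes> e) \<otimes> g" "x \<otimes> inv e = (u \<otimes> inv e) \<otimes> g"
    using uvw e g by (simp_all add: eq m_ac)
  ultimately show "x \<otimes> (y \<otimes> inv z) \<in> (H - P) #> g \<or> x \<otimes> inv (y \<otimes> inv z) \<in> (H - P) #> g"
    unfolding yz using mem uvw e by auto
qed

end

theorem corollary1:
  fixes G :: "('a, 'b) monoid_scheme" (structure) and X :: "'a set"
  assumes "comm_group G" and "periodic G" and "X \<subseteq> carrier G"
  shows "semiaffine G X \<longleftrightarrow>
    (\<exists>H a b. subgroup H G \<and> a \<in> X \<and> b \<in> X \<and> X = (H #> a) \<union> (H #> b)) \<or>
    (\<exists>g P H. g \<in> carrier G \<and> subgroup P G \<and> subgroup H G \<and> P \<subseteq> H \<and>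
       (\<forall>c \<in> carrier ((G\<lparr>carrier := H\<rparr>) Mod P).
          \<not> has_even_order ((G\<lparr>carrier := H\<rparr>) Mod P) c) \<and>
       X = (H - P) #> g)"
    (is "_ \<longleftrightarrow> ?two_cosets \<or> ?coset_diff")
proof -
  interpret comm_group G by fact
  show ?thesis
  proof
    assume sa: "semiaffine G X"
    show "?two_cosets \<or> ?coset_diff"
    proof (cases "X = {}")
      case True
      \<comment> \<open>The first form needs points of \<open>X\<close>, so the empty set takes the
        second with \<open>P\<close> and \<open>H\<close> both trivial.\<close>
      have "\<forall>h\<in>{\<one>}. h \<otimes> h \<in> {\<one>} \<longrightarrow> h \<in> {\<one>}" by simp
      then show ?thesis
        using True quotient_no_even_order_iff[OF triv_subgroup triv_subgroup subset_refl]
        by (intro disjI2 exI[of _ \<one>] exI[of _ "{\<one>}"]) (auto simp: r_coset_def triv_subgroup)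
    next
      case False
      then obtain x where x: "x \<in> X" by blast
      define S where "S = stabilizer G (diffs G X)"
      have S: "subgroup S G" unfolding S_def by (rule stabilizer_subgroup) (auto simp: diffs_def)
      show ?thesis
      proof (cases "\<exists>a\<in>X. \<exists>b\<in>X. b \<otimes> inv a \<notin> S")
        case True
        then show ?thesis using semiaffine_two_cosets[OF sa] S unfolding S_def by blast
      next
        case False
        then have DS: "diffs G X = S"
          using semiaffine_single_coset[OF sa x] unfolding S_def by blast
        show ?thesis
        proof (cases "X = S #> x")
          case True
          \<comment> \<open>A full coset is the two-coset form with \<open>a\<close> and
            \<open>b\<close> both equal to \<open>x\<close>.\<close>
          then show ?thesis using S x by blast
        next
          case neq: False
          obtain P g where "g \<in> carrier G" "subgroup P G" "P \<subseteq> S" "\<forall>h\<in>S. h \<otimes> h \<in> P \<longrightarrow> h \<in> P"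
            "X = (S - P) #> g"
            using semiaffine_coset_diff[OF assms(2) sa x S DS neq] by blast
          then show ?thesis
            using quotient_no_even_order_iff[OF _ S] S by (intro disjI2) blast
        qed
      qed
    qed
  next
    assume "?two_cosets \<or> ?coset_diff"
    then show "semiaffine G X"
    proof
      assume ?two_cosets
      then show ?thesis using two_cosets_semiaffine assms(3) by blast
    next
      assume ?coset_diff
      then obtain g P H where *: "g \<in> carrier G" "subgroup P G" "subgroup H G" "P \<subseteq> H"
         "\<forall>h\<in>H. h \<otimes> h \<in> P \<longrightarrow> h \<in> P" "X = (H - P) #> g"
        using quotient_no_even_order_iff by metis
      then show ?thesis using coset_diff_semiaffine by blast
    qed
  qed
qed

end
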